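(* Let $A=(a_{ij})$ be a real $2\times n$ matrix of rank $2$, $\mathbf b=(b_1,b_2)^T\in\mathbb R^2$ nonzero, and $\mathbf c=(c_1,\dots,c_n)^T\in\mathbb R^n$. Let $\mathcal I=\{i: b_1a_{2i}-b_2a_{1i}\ne0\}$ and let $\mathcal C\subset\mathbb P^2$ be the complex projective curve, with coordinates $[y_0:y_1:y_2]$, defined by $$\sum_{i\in\mathcal I}(b_1a_{2i}-b_2a_{1i})\prod_{j\in\mathcal I\setminus\{i\}}(a_{1j}y_1+a_{2j}y_2-c_jy_0)=0 .$$ Then $\mathcal C$ is hyperbolic with respect to the point $[0:-b_2:b_1]$; that is, every line in $\mathbb P^2(\mathbb R)$ passing through $[0:-b_2:b_1]$ meets $\mathcal C$ only in real points.
   Context: The curve $\mathcal C$ is the projective closure of the plane dual central curve of the linear program: minimize $\mathbf b^T\mathbf y$ subject to $A^T\mathbf y\ge\mathbf c$. A real line (one defined by a linear form with real coefficients) "meets $\mathcal C$ only in real points" means that all of its complex intersection points with $\mathcal C$ have a representative with real homogeneous coordinates. *)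

theory Defs
  imports "HOL-Analysis.Analysis"
begin

text \<open>
  Homogeneous coordinates \<open>[y0 : y1 : y2]\<close> are vectors of type \<open>complex ^ 3\<close>.  The index type
  is numbered from 1, so \<open>y0\<close>, \<open>y1\<close>, \<open>y2\<close> are \<open>y $ 1\<close>, \<open>y $ 2\<close>, \<open>y $ 3\<close>.
  A point of the complex projective plane is the set of all its homogeneous coordinate vectors.
\<close>

definition proj_rel :: "((complex ^ 3) \<times> (complex ^ 3)) set" where
  "proj_rel = {(u, v). u \<noteq> 0 \<and> v \<noteq> 0 \<and> (\<exists>k. k \<noteq> 0 \<and> v = k *s u)}"

definition proj_plane :: "(complex ^ 3) set set" where
  "proj_plane = (UNIV - {0}) // proj_rel"

definition proj_point :: "complex \<Rightarrow> complex \<Rightarrow> complex \<Rightarrow> (complex ^ 3) set" where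
  "proj_point y0 y1 y2 = proj_rel `` {vector [y0, y1, y2]}"

definition real_point :: "(complex ^ 3) set \<Rightarrow> bool" where
  "real_point P \<longleftrightarrow> (\<exists>y \<in> P. \<forall>i. y $ i \<in> \<real>)"

text \<open>The zero locus; it is used below only for homogeneous functions, for which vanishing does
  not depend on the chosen representative.\<close>

definition proj_zeros :: "(complex ^ 3 \<Rightarrow> complex) \<Rightarrow> (complex ^ 3) set set" where
  "proj_zeros F = {P \<in> proj_plane. \<forall>y \<in> P. F y = 0}"

definition real_line :: "real ^ 3 \<Rightarrow> (complex ^ 3) set set" where
  "real_line l = proj_zeros (\<lambda>y. \<Sum>i\<in>UNIV. complex_of_real (l $ i) * y $ i)"

definition hyperbolic_wrt :: "(complex ^ 3) set set \<Rightarrow> (complex ^ 3) set \<Rightarrow> bool" where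
  "hyperbolic_wrt C e \<longleftrightarrow>
     (\<forall>l. l \<noteq> 0 \<and> e \<in> real_line l \<longrightarrow> (\<forall>P \<in> real_line l \<inter> C. real_point P))"

definition dir_coeff :: "real ^ 'n ^ 2 \<Rightarrow> real ^ 2 \<Rightarrow> 'n \<Rightarrow> real" where
  "dir_coeff A b i = b $ 1 * A $ 2 $ i - b $ 2 * A $ 1 $ i"

definition central_index :: "real ^ 'n ^ 2 \<Rightarrow> real ^ 2 \<Rightarrow> 'n set" where
  "central_index A b = {i. dir_coeff A b i \<noteq> 0}"

definition central_form ::
    "real ^ 'n ^ 2 \<Rightarrow> real ^ 2 \<Rightarrow> real ^ 'n \<Rightarrow> complex ^ 3 \<Rightarrow> complex" where
  "central_form A b c y =
     (\<Sum>i\<in>central_index A b. complex_of_real (dir_coeff A b i) *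
        (\<Prod>j\<in>central_index A b - {i}.
           complex_of_real (A $ 1 $ j) * y $ 2 + complex_of_real (A $ 2 $ j) * y $ 3
             - complex_of_real (c $ j) * y $ 1))"

definition central_curve ::
    "real ^ 'n ^ 2 \<Rightarrow> real ^ 2 \<Rightarrow> real ^ 'n \<Rightarrow> (complex ^ 3) set set" where
  "central_curve A b c = proj_zeros (central_form A b c)"

lemma central_form_homogeneous:
  fixes A :: "real ^ 'n ^ 2"
  shows "central_form A b c (k *s y) = k ^ (card (central_index A b) - 1) * central_form A b c y"
proof -
  let ?I = "central_index A b"
  let ?L = "\<lambda>y j. complex_of_real (A $ 1 $ j) * y $ 2 + complex_of_real (A $ 2 $ j) * y $ 3
             - complex_of_real (c $ j) * y $ 1"
  have L: "?L (k *s y) j = k * ?L y j" for j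
    by (simp add: algebra_simps)
  have "(\<Prod>j\<in>?I - {i}. ?L (k *s y) j) = k ^ (card ?I - 1) * (\<Prod>j\<in>?I - {i}. ?L y j)"
    if "i \<in> ?I" for i
    unfolding L using that by (simp add: prod.distrib)
  then show ?thesis
    unfolding central_form_def sum_distrib_left by (intro sum.cong) (simp_all add: mult_ac)
qed

end

theory Submission
  imports Defs
begin

text \<open>
  A line through \<open>e = [0 : -b\<^sub>2 : b\<^sub>1]\<close> is parametrized as \<open>s e + t q\<close> with \<open>q\<close> real.  On it the
  \<open>j\<close>-th linear form becomes \<open>s d\<^sub>j + t e\<^sub>j\<close> with \<open>d\<^sub>j = b\<^sub>1 a\<^sub>2\<^sub>j - b\<^sub>2 a\<^sub>1\<^sub>j\<close>, so for \<open>t = 1\<close> the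
  equation of the curve is the derivative in \<open>s\<close> of the product of the \<open>s d\<^sub>j + e\<^sub>j\<close>, a polynomial
  with only real roots.  By the argument of Gauss and Lucas its critical points are real.
\<close>

text \<open>Multiplying by the conjugate of the denominator leaves \<open>- Im s\<close> times a
  nonnegative factor. The terms of a logarithmic derivative thus have imaginary parts of one common
  sign, which prevents cancellation in \<open>critical_point_real\<close>.\<close>

lemma Im_of_real_divide_affine:
  fixes d e :: real and s :: complex
  shows "Im (of_real d / (s * of_real d + of_real e))
           = - Im s * (d\<^sup>2 / (cmod (s * of_real d + of_real e))\<^sup>2)"
  unfolding cmod_power2 by (simp add: Im_divide power2_eq_square)

lemma critical_point_real:
  fixes d e :: "'i \<Rightarrow> real" and s :: complex
  assumes fin: "finite I" and ne: "I \<noteq> {}" and d: "\<And>i. i \<in> I \<Longrightarrow> d i \<noteq> 0"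
    and zero: "(\<Sum>i\<in>I. of_real (d i) * (\<Prod>j\<in>I - {i}. s * of_real (d j) + of_real (e j))) = 0"
  shows "s \<in> \<real>"
proof (cases "\<exists>j\<in>I. s * of_real (d j) + of_real (e j) = 0")
  case True
  \<comment> \<open>Here \<open>s\<close> is a root of one of the real affine factors, hence itself
    real.\<close>
  then obtain j where j: "j \<in> I" "s * of_real (d j) + of_real (e j) = 0" by blast
  then have "s = of_real (- e j / d j)"
    using d[of j] by (simp add: field_simps add_eq_0_iff)
  then show ?thesis by (metis Reals_of_real)
next
  case False
  let ?L = "\<lambda>j. s * of_real (d j) + of_real (e j)"
  have L: "?L j \<noteq> 0" if "j \<in> I" for j using False that by blast
  \<comment> \<open>No factor vanishes at \<open>s\<close>, so the derivative equals the product
    times its logarithmic derivative, and the latter must vanish.\<close>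
  have "(\<Sum>i\<in>I. of_real (d i) * (\<Prod>j\<in>I - {i}. ?L j)) = (\<Sum>i\<in>I. of_real (d i) / ?L i) * prod ?L I"
    unfolding sum_distrib_right
    by (intro sum.cong refl) (use L in \<open>simp add: prod.remove[OF fin]\<close>)
  then have "(\<Sum>i\<in>I. of_real (d i) / ?L i) = 0"
    using zero L fin by simp
  then have "(\<Sum>i\<in>I. Im (of_real (d i) / ?L i)) = 0"
    by (metis Im_sum zero_complex.sel(2))
  then have "Im s * (\<Sum>i\<in>I. (d i)\<^sup>2 / (cmod (?L i))\<^sup>2) = 0"
    unfolding Im_of_real_divide_affine by (simp add: sum_distrib_left sum_negf)
  moreover have "(\<Sum>i\<in>I. (d i)\<^sup>2 / (cmod (?L i))\<^sup>2) > 0"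
    using fin ne L d by (intro sum_pos) auto
  ultimately show ?thesis by (simp add: complex_is_Real_iff)
qed

text \<open>If all \<open>dir_coeff A b i\<close> vanished, the nonzero vector
  \<open>(-b2, b1)\<close> would be orthogonal to every column of \<open>A\<close>, contradicting
  rank 2. This excludes the empty sum, whose zero locus would be the whole plane.\<close>

lemma central_index_nonempty:
  fixes A :: "real ^ 'n ^ 2"
  assumes "rank A = 2" and "b \<noteq> 0"
  shows "central_index A b \<noteq> {}"
proof
  assume empty: "central_index A b = {}"
  define v :: "real ^ 2" where "v = vector [- (b $ 2), b $ 1]"
  have "transpose A *v v = 0"
    using empty
    by (auto simp: vec_eq_iff matrix_vector_mult_def transpose_def v_def sum_2 vector_2
        central_index_def dir_coeff_def algebra_simps)
  moreover have "inj ((*v) (transpose A))"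
    using assms(1) by (simp add: full_rank_injective[symmetric] rank_transpose)
  ultimately have "v = 0"
    by (metis injD matrix_vector_mult_0_right)
  then show False
    using assms(2) by (auto simp: v_def vec_eq_iff forall_2 vector_2)
qed

lemma proj_plane_scale:
  assumes "P \<in> proj_plane" "y \<in> P" "k \<noteq> 0"
  shows "k *s y \<in> P"
proof -
  obtain u where u: "P = proj_rel `` {u}"
    using assms(1) unfolding proj_plane_def by (auto elim: quotientE)
  then obtain k' where "u \<noteq> 0" "k' \<noteq> 0" "y = k' *s u"
    using assms(2) by (auto simp: proj_rel_def)
  moreover from this have "k *s y = (k * k') *s u" by simp
  ultimately show ?thesis
    using u assms(3) by (auto simp: proj_rel_def intro!: exI[of _ "k * k'"])
qed

lemma proj_plane_obtain:
  assumes "P \<in> proj_plane"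
  obtains y where "y \<in> P" "y \<noteq> 0"
proof -
  obtain u where "P = proj_rel `` {u}" "u \<noteq> 0"
    using assms unfolding proj_plane_def by (auto elim: quotientE)
  then show ?thesis
    by (intro that[of u]) (auto simp: proj_rel_def intro: exI[of _ 1])
qed

text \<open>The condition \<open>lb\<close> says that the line passes through
  \<open>[0 : -b2 : b1]\<close>. The second, real point is
  \<open>q = (m, - l1 * b1 / N, - l1 * b2 / N)\<close>, the vector on the line that is orthogonal to
  \<open>(0, -b2, b1)\<close>.\<close>

lemma line_parametrization:
  fixes b1 b2 l1 l2 l3 :: real and y1 y2 y3 :: complex
  assumes b: "b1 \<noteq> 0 \<or> b2 \<noteq> 0" and l: "l1 \<noteq> 0 \<or> l2 \<noteq> 0 \<or> l3 \<noteq> 0" and lb: "b1 * l3 = b2 * l2"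
    and y: "of_real l1 * y1 + of_real l2 * y2 + of_real l3 * y3 = 0"
  obtains q1 q2 q3 :: real and s t :: complex where
    "y1 = t * of_real q1" "y2 = - s * of_real b2 + t * of_real q2"
    "y3 = s * of_real b1 + t * of_real q3"
proof -
  define N where "N = b1\<^sup>2 + b2\<^sup>2"
  \<comment> \<open>By \<open>lb\<close> the vector \<open>(l2, l3)\<close> is parallel to
    \<open>(b1, b2)\<close>; \<open>m\<close> is the factor, found by projection.\<close>
  define m where "m = (b1 * l2 + b2 * l3) / N"
  have N: "N \<noteq> 0" using b by (simp add: N_def sum_power2_eq_zero_iff)
  have l2: "l2 = m * b1" and l3: "l3 = m * b2"
    using N lb unfolding m_def N_def by (simp_all add: field_simps power2_eq_square)
  define M where "M = m\<^sup>2 + l1\<^sup>2"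
  have M: "M \<noteq> 0" using l l2 l3 by (auto simp: M_def sum_power2_eq_zero_iff)
  \<comment> \<open>Up to the factor \<open>N\<close>, \<open>w\<close> and \<open>s\<close> are the
    coordinates of \<open>(y2, y3)\<close> along the orthogonal vectors \<open>(b1, b2)\<close> and
    \<open>(-b2, b1)\<close>. The line equation becomes \<open>l1 * y1 + m * w = 0\<close>, so
    \<open>(y1, w)\<close> is a multiple of \<open>(m, - l1)\<close>; \<open>t\<close> is that
    multiple.\<close>
  define w where "w = of_real b1 * y2 + of_real b2 * y3"
  define s where "s = (of_real b1 * y3 - of_real b2 * y2) / of_real N"
  define t where "t = (of_real m * y1 - of_real l1 * w) / of_real M"
  have rel: "of_real l1 * y1 + of_real m * w = 0"
    using y by (simp add: l2 l3 w_def algebra_simps)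
  have sN: "s * of_real N = of_real b1 * y3 - of_real b2 * y2"
    and tM: "t * of_real M = of_real m * y1 - of_real l1 * w"
    using N M by (simp_all add: s_def t_def)
  have CN: "complex_of_real N = of_real b1 ^ 2 + of_real b2 ^ 2"
    and CM: "complex_of_real M = of_real m ^ 2 + of_real l1 ^ 2"
    by (simp_all add: N_def M_def)
  have "of_real M * (t * of_real m) = of_real M * y1"
    using tM rel unfolding CM by algebra
  then have y1: "y1 = t * of_real m" using M by simp
  have "of_real M * (- t * of_real l1) = of_real M * w"
    using tM rel unfolding CM by algebra
  then have w: "w = - t * of_real l1"
    using M by (simp only: mult_cancel_left of_real_eq_0_iff simp_thms)
  have "of_real N * y2 = of_real N * (- s * of_real b2) + w * of_real b1"
    using sN unfolding CN w_def by algebra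
  then have y2: "y2 = - s * of_real b2 + t * of_real (- l1 * b1 / N)"
    using N by (simp add: w field_simps)
  have "of_real N * y3 = of_real N * (s * of_real b1) + w * of_real b2"
    using sN unfolding CN w_def by algebra
  then have y3: "y3 = s * of_real b1 + t * of_real (- l1 * b2 / N)"
    using N by (simp add: w field_simps)
  show ?thesis using that[OF y1 y2 y3] .
qed

theorem proposition4:
  fixes A :: "real ^ 'n ^ 2" and b :: "real ^ 2" and c :: "real ^ 'n"
  assumes "rank A = 2" and "b \<noteq> 0"
  shows "hyperbolic_wrt (central_curve A b c)
           (proj_point 0 (complex_of_real (- (b $ 2))) (complex_of_real (b $ 1)))"
  unfolding hyperbolic_wrt_def
proof (intro allI impI ballI, elim conjE)
  fix l :: "real ^ 3" and P
  let ?e = "vector [0, complex_of_real (- (b $ 2)), complex_of_real (b $ 1)] :: complex ^ 3"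
  assume l0: "l \<noteq> 0"
    and el: "proj_point 0 (complex_of_real (- (b $ 2))) (complex_of_real (b $ 1)) \<in> real_line l"
    and P: "P \<in> real_line l \<inter> central_curve A b c"
  have b: "b $ 1 \<noteq> 0 \<or> b $ 2 \<noteq> 0"
    using assms(2) by (auto simp: vec_eq_iff forall_2)
  have "?e \<noteq> 0" using b by (auto simp: vec_eq_iff forall_3 vector_3)
  then have "?e \<in> proj_rel `` {?e}"
    by (auto simp: proj_rel_def intro: exI[of _ 1])
  then have "(\<Sum>i\<in>UNIV. complex_of_real (l $ i) * ?e $ i) = 0"
    using el unfolding proj_point_def real_line_def proj_zeros_def by blast
  then have "complex_of_real (b $ 1 * l $ 3) = complex_of_real (b $ 2 * l $ 2)"
    by (simp add: sum_3 vector_3 mult.commute)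
  then have lb: "b $ 1 * l $ 3 = b $ 2 * l $ 2"
    by (simp only: of_real_eq_iff)
  have PP: "P \<in> proj_plane" using P by (simp add: real_line_def proj_zeros_def)
  then obtain y where y: "y \<in> P" "y \<noteq> 0" by (rule proj_plane_obtain)
  have "of_real (l $ 1) * y $ 1 + of_real (l $ 2) * y $ 2 + of_real (l $ 3) * y $ 3 = 0"
    using P y by (auto simp: real_line_def proj_zeros_def sum_3)
  moreover have "l $ 1 \<noteq> 0 \<or> l $ 2 \<noteq> 0 \<or> l $ 3 \<noteq> 0"
    using l0 by (auto simp: vec_eq_iff forall_3)
  ultimately obtain q1 q2 q3 :: real and s t :: complex where
    st: "y $ 1 = t * of_real q1" "y $ 2 = - s * of_real (b $ 2) + t * of_real q2"
        "y $ 3 = s * of_real (b $ 1) + t * of_real q3"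
    using line_parametrization[OF b _ lb] by metis
  show "real_point P"
  proof (cases "t = 0")
    \<comment> \<open>Here \<open>P\<close> is the point \<open>[0 : -b2 : b1]\<close>
      itself.\<close>
    case True
    then have "s \<noteq> 0" using st y(2) by (auto simp: vec_eq_iff forall_3)
    then have "inverse s *s y \<in> P" using proj_plane_scale[OF PP y(1)] by simp
    moreover have "\<forall>i. (inverse s *s y) $ i \<in> \<real>"
      using True \<open>s \<noteq> 0\<close> by (simp add: forall_3 st mult.assoc[symmetric])
    ultimately show ?thesis unfolding real_point_def by blast
  next
    case False
    \<comment> \<open>Rescaling to \<open>t = 1\<close> gives \<open>z = r e + q\<close> with
      \<open>e\<close> and \<open>q\<close> real, so it suffices that \<open>r\<close> is
      real.\<close>
    define z where "z = inverse t *s y"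
    define r where "r = s / t"
    have zP: "z \<in> P" using proj_plane_scale[OF PP y(1)] False by (simp add: z_def)
    have z: "z $ 1 = of_real q1" "z $ 2 = - r * of_real (b $ 2) + of_real q2"
        "z $ 3 = r * of_real (b $ 1) + of_real q3"
      using False by (simp_all add: z_def r_def st field_simps)
    \<comment> \<open>The value of the \<open>j\<close>-th linear form at \<open>q\<close>; its
      value at \<open>[0 : -b2 : b1]\<close> is \<open>dir_coeff A b j\<close>.\<close>
    let ?e' = "\<lambda>j. A $ 1 $ j * q2 + A $ 2 $ j * q3 - c $ j * q1"
    have L: "complex_of_real (A $ 1 $ j) * z $ 2 + complex_of_real (A $ 2 $ j) * z $ 3
             - complex_of_real (c $ j) * z $ 1 = r * of_real (dir_coeff A b j) + of_real (?e' j)" for j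
      by (simp add: z dir_coeff_def algebra_simps)
    have "central_form A b c z = 0"
      using P zP by (auto simp: central_curve_def proj_zeros_def)
    then have "(\<Sum>i\<in>central_index A b. of_real (dir_coeff A b i) *
        (\<Prod>j\<in>central_index A b - {i}. r * of_real (dir_coeff A b j) + of_real (?e' j))) = 0"
      unfolding central_form_def L .
    then have "r \<in> \<real>"
      by (rule critical_point_real[OF finite central_index_nonempty[OF assms], rotated])
        (simp add: central_index_def)
    then have "\<forall>i. z $ i \<in> \<real>"
      by (simp add: forall_3 z)
    then show ?thesis unfolding real_point_def using zP by blast
  qed
qed

end
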